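(* Let $X$ and $Y$ be real random variables, and let $\beta:\mathbf{R}\to\mathbf{R}$ be of bounded variation, in the sense that $\beta=\beta_1-\beta_2$ for two non-decreasing functions $\beta_1,\beta_2:\mathbf{R}\to\mathbf{R}$. Assume that the expectations of $X$, $\beta(Y)$ and $X\beta(Y)$ are well-defined and finite. Then, for every pair $p,q\in(1,\infty)$ such that $p^{-1}+q^{-1}=1$, we have the bound $$\big|\mathbf{Cov}[X,\beta(Y)]\big|\le \mathbf{D}_p[X,Y]\,\mathbf{G}_p[X,Y,\beta],$$ where $$\mathbf{D}_p[X,Y]=\sup_{y}\frac{\big|\mathbf{Cov}[X,\tau_y(Y)]\big|}{\mathbf{A}_p[X]\,\mathbf{A}_q[\tau_y(Y)]},$$ with the supremum taken over all $y\in\mathbf{R}$ such that $G(y)\in(0,1)$, and where $$\mathbf{G}_p[X,Y,\beta]=\mathbf{A}_p[X]\int \mathbf{A}_q[\tau_y(Y)]\,d|\beta|(y).$$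
   Context: $G$ denotes the cumulative distribution function of $Y$, $G(y)=\mathbf{P}[Y\le y]$; the set of $y$ with $G(y)\in(0,1)$ is what is referred to here as the support of $Y$. For a real number $y$, $\tau_y(Y)=\mathbf{1}\{Y>y\}$ is the random variable equal to $1$ when $Y>y$ and $0$ otherwise. For a random variable $Z$, $\mathbf{A}_k[Z]=\big(\mathbf{E}\big[|Z-\mathbf{E}[Z]|^k\big]\big)^{1/k}$. The function $|\beta|:\mathbf{R}\to\mathbf{R}$ is defined by $|\beta|(y)=\beta_1(y)+\beta_2(y)$ (so that $d|\beta|(y)=|\beta'(y)|\,dy$ when $\beta$ is differentiable). $\mathbf{D}_p[X,Y]$ is called the dependence coefficient (based on quadrant dependence in expectation) and $\mathbf{G}_p[X,Y,\beta]$ the corresponding Grüss factor. The bound is a consequence of the representation $\mathbf{Cov}[X,\beta(Y)]=\int\mathbf{Cov}[X,\tau_y(Y)]\,d\beta(y)$.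
   Formalization: A_p[X] is assumed finite, and the integral against d|β| is the interior Stieltjes integral (at a jump y, |β|(y)−|β|(y−) is weighted by the left limit of the integrand, |β|(y+)−|β|(y) by the right limit); with the plain Lebesgue–Stieltjes integral the bound fails when Y has atoms. *)

theory Defs
  imports "HOL-Probability.Probability"
begin

definition covar :: "'a measure \<Rightarrow> ('a \<Rightarrow> real) \<Rightarrow> ('a \<Rightarrow> real) \<Rightarrow> real" where
  "covar M X Z = (\<integral>\<omega>. (X \<omega> - (\<integral>\<omega>'. X \<omega>' \<partial>M)) * (Z \<omega> - (\<integral>\<omega>'. Z \<omega>' \<partial>M)) \<partial>M)"

text \<open>The quantity A_k[Z]. It is real-valued, so it is meaningful only when the k-th absolute
  central moment of Z is finite.\<close>

definition central_norm :: "'a measure \<Rightarrow> real \<Rightarrow> ('a \<Rightarrow> real) \<Rightarrow> real" where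
  "central_norm M k Z = (\<integral>\<omega>. \<bar>Z \<omega> - (\<integral>\<omega>'. Z \<omega>' \<partial>M)\<bar> powr k \<partial>M) powr (1 / k)"

definition tau :: "real \<Rightarrow> real \<Rightarrow> real" where
  "tau y t = (if t > y then 1 else 0)"

text \<open>The Lebesgue-Stieltjes measure of a non-decreasing b that need not be continuous from either
  side: it gives the mass b(y+) - b(y-) to each point y.\<close>

definition stieltjes_measure :: "(real \<Rightarrow> real) \<Rightarrow> real measure" where
  "stieltjes_measure b = interval_measure (\<lambda>y. Lim (at_right y) b)"

text \<open>The integral of a nonnegative f (with one-sided limits) against db, for an arbitrary
  non-decreasing b. It is the Lebesgue-Stieltjes integral, except that at a jump of b the part
  b(y) - b(y-) is weighted with f(y-) and the part b(y+) - b(y) with f(y+) (the ``interior''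
  Stieltjes integral, whose approximating sums evaluate f strictly inside each partition
  interval). The two integrals agree as soon as f and b have no common discontinuity from
  the same side; see the lemma below.

  For a non-decreasing b whose value at a jump is arbitrary, this is the convention under which
  Cov[X, b(Y)] is the integral of Cov[X, 1{Y > y}] against db(y), because 1{Y > y} sees the part
  b(y+) - b(y) of a jump, whereas the part b(y) - b(y-) enters b(Y) through 1{Y \<ge> y}, the limit of
  1{Y > z} as z increases to y. The plain Lebesgue-Stieltjes integral gives a different value when
  Y has an atom at a point where b is not left-continuous, and the Gruess bound then fails: for
  X = Y uniform on {0, 1} and b = 1{y \<ge> 1} the covariance is 1/4, but 1{Y > 1} is constant.\<close>

definition jump_average :: "(real \<Rightarrow> real) \<Rightarrow> (real \<Rightarrow> real) \<Rightarrow> real \<Rightarrow> real" where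
  "jump_average f b y =
     (let bl = Lim (at_left y) b; br = Lim (at_right y) b in
      if bl = br then f y
      else ((b y - bl) * Lim (at_left y) f + (br - b y) * Lim (at_right y) f) / (br - bl))"

definition stieltjes_nn_integral :: "(real \<Rightarrow> real) \<Rightarrow> (real \<Rightarrow> real) \<Rightarrow> ennreal" where
  "stieltjes_nn_integral f b = (\<integral>\<^sup>+ y. ennreal (jump_average f b y) \<partial>stieltjes_measure b)"

lemma stieltjes_nn_integral_eq_Lebesgue_Stieltjes:
  assumes left: "\<And>y. continuous (at_left y) b \<or> continuous (at_left y) f"
    and right: "\<And>y. continuous (at_right y) b \<or> continuous (at_right y) f"
  shows "stieltjes_nn_integral f b = (\<integral>\<^sup>+ y. ennreal (f y) \<partial>stieltjes_measure b)"
proof -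
  have lim: "Lim (at_left y) g = g y" if "continuous (at_left y) g" for y and g :: "real \<Rightarrow> real"
    using that by (intro tendsto_Lim) (auto simp: continuous_within)
  have lim': "Lim (at_right y) g = g y" if "continuous (at_right y) g" for y and g :: "real \<Rightarrow> real"
    using that by (intro tendsto_Lim) (auto simp: continuous_within)
  have "jump_average f b y = f y" for y
  proof -
    define bl br where "bl = Lim (at_left y) b" and "br = Lim (at_right y) b"
    have 1: "(b y - bl) * Lim (at_left y) f = (b y - bl) * f y"
      using left[of y] lim[of y] by (auto simp: bl_def)
    have 2: "(br - b y) * Lim (at_right y) f = (br - b y) * f y"
      using right[of y] lim'[of y] by (auto simp: br_def)
    have 3: "jump_average f b y =
        (if bl = br then f y
         else ((b y - bl) * Lim (at_left y) f + (br - b y) * Lim (at_right y) f) / (br - bl))"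
      by (simp add: jump_average_def bl_def br_def Let_def)
    show ?thesis
      unfolding 3 1 2 by (simp add: field_simps)
  qed
  then show ?thesis
    by (simp add: stieltjes_nn_integral_def)
qed

text \<open>D_p[X,Y], where q is the conjugate exponent of p. If X is almost surely constant, the
  quotient 0/0 is read as 0; if Y is almost surely constant, the supremum is over the empty set
  and is 0.\<close>

definition dependence_coeff ::
    "'a measure \<Rightarrow> real \<Rightarrow> real \<Rightarrow> ('a \<Rightarrow> real) \<Rightarrow> ('a \<Rightarrow> real) \<Rightarrow> ennreal" where
  "dependence_coeff M p q X Y =
     (SUP y \<in> {y. 0 < cdf (distr M borel Y) y \<and> cdf (distr M borel Y) y < 1}.
        ennreal (\<bar>covar M X (\<lambda>\<omega>. tau y (Y \<omega>))\<bar> /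
                 (central_norm M p X * central_norm M q (\<lambda>\<omega>. tau y (Y \<omega>)))))"

text \<open>G_p[X,Y,beta], as a function of the non-decreasing function v = |beta|. It may be infinite.\<close>

definition gruess_factor ::
    "'a measure \<Rightarrow> real \<Rightarrow> real \<Rightarrow> ('a \<Rightarrow> real) \<Rightarrow> ('a \<Rightarrow> real) \<Rightarrow> (real \<Rightarrow> real) \<Rightarrow> ennreal" where
  "gruess_factor M p q X Y v =
     ennreal (central_norm M p X) *
     stieltjes_nn_integral (\<lambda>y. central_norm M q (\<lambda>\<omega>. tau y (Y \<omega>))) v"

end

theory Submission
  imports Defs
begin

text \<open>Put \<open>v = |\<beta>| = \<beta>\<^sub>1 + \<beta>\<^sub>2\<close> and \<open>Z = X - E[X]\<close>. Increments of \<open>\<beta>\<close> are dominated by those of \<open>v\<close>, so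
  \<open>\<beta> = B \<circ> v\<close> for a 1-Lipschitz \<open>B\<close>, and hence \<open>|E[Z \<beta>(Y)]| \<le> \<integral> |E[Z 1{v(Y) > u}]| du\<close>; this needs no
  integrability of \<open>\<beta>\<^sub>1(Y)\<close> and \<open>\<beta>\<^sub>2(Y)\<close> separately. The set \<open>{v > u}\<close> is an open or closed upper
  half-line, so the integrand is at most \<open>D\<^sub>p A\<^sub>p[X] A\<^sub>q[1{v(Y) > u}]\<close>, for closed half-lines by passing
  to the limit. Finally, the substitution \<open>y = inf {t. v t > u}\<close> turns Lebesgue measure \<open>du\<close> into the
  Stieltjes measure of \<open>v\<close>. At a jump \<open>y\<close> of \<open>v\<close> the levels \<open>u\<close> between \<open>v(y-)\<close> and \<open>v(y)\<close> give
  \<open>{t. t \<ge> y}\<close> and those between \<open>v(y)\<close> and \<open>v(y+)\<close> give \<open>{t. t > y}\<close>: these are exactly the weights of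
  the interior Stieltjes integral.\<close>

section \<open>Lipschitz functions of a random variable\<close>

text \<open>McShane extension: the lower envelope of the cones of slope 1 placed at the points
  \<open>(v t, f t)\<close>. It is defined on the whole line, hence also across the gaps that jumps
  of \<open>v\<close> leave in its range.\<close>

lemma lipschitz_factorization:
  fixes f v :: "'b \<Rightarrow> real"
  assumes le: "\<And>s t. \<bar>f s - f t\<bar> \<le> \<bar>v s - v t\<bar>"
  obtains B where "1-lipschitz_on UNIV B" "\<And>t. f t = B (v t)"
proof
  define B where "B x = (INF t. f t + \<bar>x - v t\<bar>)" for x
  have bdd: "bdd_below (range (\<lambda>t. f t + \<bar>x - v t\<bar>))" for x
  proof (rule bdd_belowI2)
    \<comment> \<open>\<open>undefined\<close> serves as an arbitrary but fixed reference point;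
      comparing every cone with it gives a lower bound independent of \<open>t\<close>.\<close>
    fix t show "f undefined - \<bar>x - v undefined\<bar> \<le> f t + \<bar>x - v t\<bar>"
      using le[of undefined t] by linarith
  qed
  have *: "B x \<le> B y + \<bar>x - y\<bar>" for x y
  proof -
    have "B x - \<bar>x - y\<bar> \<le> B y"
      unfolding B_def[of y]
    proof (rule cINF_greatest)
      fix t
      have "B x \<le> f t + \<bar>x - v t\<bar>"
        unfolding B_def using bdd by (rule cINF_lower) simp
      then show "B x - \<bar>x - y\<bar> \<le> f t + \<bar>y - v t\<bar>" by linarith
    qed simp
    then show ?thesis by simp
  qed
  have "dist (B x) (B y) \<le> 1 * dist x y" for x y
    using *[of x y] *[of y x] by (simp add: dist_real_def)
  then show "1-lipschitz_on UNIV B"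
    by (simp add: lipschitz_on_def)
  show "f t = B (v t)" for t
  proof (rule antisym)
    show "f t \<le> B (v t)"
      unfolding B_def
    proof (rule cINF_greatest)
      show "f t \<le> f s + \<bar>v t - v s\<bar>" for s using le[of t s] by linarith
    qed simp
    show "B (v t) \<le> f t"
      unfolding B_def using cINF_lower[OF bdd[of "v t"], of t] by simp
  qed
qed

lemma measurable_tau [measurable]:
  assumes [measurable]: "f \<in> borel_measurable M" "g \<in> borel_measurable M"
  shows "(\<lambda>x. tau (f x) (g x)) \<in> borel_measurable M"
  unfolding tau_def by measurable

lemma abs_tau_le [simp]: "\<bar>tau u w\<bar> \<le> 1"
  by (simp add: tau_def)

lemma integrable_mult_tau [simp]:
  assumes Z: "integrable M Z" and [measurable]: "W \<in> borel_measurable M"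
  shows "integrable M (\<lambda>\<omega>. Z \<omega> * tau u (W \<omega>))"
proof (rule Bochner_Integration.integrable_bound[OF Z])
  show "(\<lambda>\<omega>. Z \<omega> * tau u (W \<omega>)) \<in> borel_measurable M" using Z by measurable
qed (simp add: tau_def)

text \<open>For a continuously differentiable \<open>B\<close> this is Fubini's theorem applied to
  \<open>B w - B a = \<integral> B' u * tau u w du\<close>; a Lipschitz \<open>B\<close> is uniformly close to its moving averages
  over \<open>[x, x + \<epsilon>]\<close>, whose derivatives are difference quotients of \<open>B\<close>.\<close>

lemma lipschitz_integral_bound_bounded:
  fixes Z W :: "'a \<Rightarrow> real" and B :: "real \<Rightarrow> real"
  assumes "prob_space M" and Z: "integrable M Z" "(\<integral>\<omega>. Z \<omega> \<partial>M) = 0"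
    and W [measurable]: "W \<in> borel_measurable M" and W_bounds: "\<And>\<omega>. a \<le> W \<omega>" "\<And>\<omega>. W \<omega> \<le> b"
    and lip: "1-lipschitz_on UNIV B"
  shows "ennreal \<bar>\<integral>\<omega>. Z \<omega> * B (W \<omega>) \<partial>M\<bar>
           \<le> (\<integral>\<^sup>+u. ennreal \<bar>\<integral>\<omega>. Z \<omega> * tau u (W \<omega>) \<partial>M\<bar> \<partial>lborel)"
proof (rule ennreal_le_epsilon)
  interpret prob_space M by fact
  interpret P: pair_sigma_finite M lborel by standard
  have [measurable]: "Z \<in> borel_measurable M" using Z by simp
  have B_lip: "\<bar>B x - B y\<bar> \<le> \<bar>x - y\<bar>" for x y
    using lipschitz_onD[OF lip, of x y] by (simp add: dist_real_def)
  have cont_B: "continuous_on UNIV B"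
    using lip lipschitz_on_continuous_on by blast
  then have isCont_B: "isCont B x" for x
    by (simp add: continuous_on_eq_continuous_at)
  have [measurable]: "B \<in> borel_measurable borel"
    using cont_B by (rule borel_measurable_continuous_onI)
  obtain \<Phi> where \<Phi>: "\<And>x. (\<Phi> has_real_derivative B x) (at x)"
    using einterval_antiderivative[of "-\<infinity>" \<infinity> B] isCont_B
    by (auto simp: has_real_derivative_iff_has_vector_derivative)
  fix e :: real assume "0 < e"
  \<comment> \<open>The \<open>+ 1\<close> keeps the denominator positive when \<open>Z\<close>
    vanishes almost surely. Replacing \<open>B\<close> by a function within
    \<open>\<epsilon>\<close> of it then costs at most \<open>e\<close>.\<close>
  define \<epsilon> where "\<epsilon> = e / ((\<integral>\<omega>. \<bar>Z \<omega>\<bar> \<partial>M) + 1)"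
  have nn: "0 \<le> (\<integral>\<omega>. \<bar>Z \<omega>\<bar> \<partial>M)" by simp
  have eps: "0 < \<epsilon>" "\<epsilon> * (\<integral>\<omega>. \<bar>Z \<omega>\<bar> \<partial>M) \<le> e"
    using \<open>0 < e\<close> nn unfolding \<epsilon>_def by (auto simp: divide_simps add_nonneg_pos)
  define D where "D u = (B (u + \<epsilon>) - B u) / \<epsilon>" for u
  define F where "F x = (\<Phi> (x + \<epsilon>) - \<Phi> x) / \<epsilon>" for x
  have [measurable]: "D \<in> borel_measurable borel" unfolding D_def by measurable
  have DF: "(F has_real_derivative D x) (at x)" for x
  proof -
    have "((\<lambda>x. \<Phi> (x + \<epsilon>)) has_real_derivative B (x + \<epsilon>)) (at x)"
      using \<Phi>[of "x + \<epsilon>"] by (simp add: DERIV_shift)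
    then show ?thesis
      unfolding F_def D_def by (intro DERIV_cdivide DERIV_diff \<Phi>)
  qed
  have contF: "continuous_on UNIV F"
    using DF by (intro continuous_at_imp_continuous_on) (auto intro: DERIV_isCont)
  then have [measurable]: "F \<in> borel_measurable borel"
    by (rule borel_measurable_continuous_onI)
  have D_bound: "\<bar>D u\<bar> \<le> 1" for u
    using B_lip[of "u + \<epsilon>" u] eps(1) by (simp add: D_def divide_simps)
  have isCont_D: "isCont D u" for u
  proof -
    have "isCont (\<lambda>u. B (u + \<epsilon>)) u"
      by (rule isCont_o2[OF _ isCont_B]) simp
    then show ?thesis unfolding D_def using isCont_B eps(1) by (intro continuous_intros) auto
  qed
  \<comment> \<open>By the mean value theorem the moving average \<open>F x\<close> is a value of
    \<open>B\<close> at some point of the window, at distance less than \<open>\<epsilon>\<close>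
    from \<open>x\<close>.\<close>
  have FB: "\<bar>B x - F x\<bar> \<le> \<epsilon>" for x
  proof -
    obtain z where z: "x < z" "z < x + \<epsilon>" "\<Phi> (x + \<epsilon>) - \<Phi> x = (x + \<epsilon> - x) * B z"
      using MVT2[of x "x + \<epsilon>" \<Phi> B] \<Phi> eps(1) by auto
    then have "F x = B z" using eps(1) by (simp add: F_def)
    then show ?thesis using B_lip[of x z] z by simp
  qed
  \<comment> \<open>The indicator makes the product integrable for Fubini. Since
    \<open>W \<le> b\<close>, cutting at \<open>b\<close> removes nothing, and cutting at
    \<open>a\<close> produces the primitive \<open>F (W \<omega>) - F a\<close>.\<close>
  define k where "k \<omega> u = Z \<omega> * (D u * tau u (W \<omega>) * indicator {a..b} u)" for \<omega> u
  have k_meas [measurable]: "case_prod k \<in> borel_measurable (M \<Otimes>\<^sub>M lborel)"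
    unfolding k_def by measurable
  have int0: "integrable (M \<Otimes>\<^sub>M lborel) (\<lambda>(\<omega>, u). Z \<omega> * indicator {a..b} u)"
  proof (rule P.Fubini_integrable)
    show "integrable M (\<lambda>\<omega>. \<integral>u. norm (case (\<omega>, u) of (\<omega>, u) \<Rightarrow> Z \<omega> * indicator {a..b} u) \<partial>lborel)"
      using Z by (simp add: abs_mult)
    show "AE \<omega> in M. integrable lborel (\<lambda>u. case (\<omega>, u) of (\<omega>, u) \<Rightarrow> Z \<omega> * indicator {a..b} u)"
      by (auto intro!: integrable_mult_right simp: emeasure_lborel_Icc_eq)
  qed measurable
  have k_int: "integrable (M \<Otimes>\<^sub>M lborel) (case_prod k)"
  proof (rule Bochner_Integration.integrable_bound[OF int0 k_meas])
    have "\<bar>D u\<bar> * \<bar>tau u w\<bar> \<le> 1" for u w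
      using D_bound[of u] by (simp add: tau_def)
    then have "norm (k \<omega> u) \<le> norm (Z \<omega> * indicator {a..b} u)" for \<omega> u
      by (auto simp: k_def abs_mult intro!: mult_left_le split: split_indicator)
    then show "AE x in M \<Otimes>\<^sub>M lborel. norm (case_prod k x)
        \<le> norm (case x of (\<omega>, u) \<Rightarrow> Z \<omega> * indicator {a..b} u)"
      by auto
  qed
  have k1: "(\<integral>u. k \<omega> u \<partial>lborel) = Z \<omega> * (F (W \<omega>) - F a)" for \<omega>
  proof -
    \<comment> \<open>\<open>tau\<close> selects \<open>u < W \<omega>\<close> while the fundamental
      theorem is stated for a closed interval; the two differ only in the null set
      \<open>{W \<omega>}\<close>.\<close>
    have "(\<integral>u. k \<omega> u \<partial>lborel) = (\<integral>u. Z \<omega> * (D u * indicator {a..W \<omega>} u) \<partial>lborel)"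
    proof (rule integral_cong_AE)
      show "AE u in lborel. k \<omega> u = Z \<omega> * (D u * indicator {a..W \<omega>} u)"
        using AE_lborel_singleton[of "W \<omega>"]
        by eventually_elim
           (use W_bounds(2)[of \<omega>] in \<open>auto simp: k_def tau_def split: split_indicator\<close>)
    qed (simp_all add: k_def)
    also have "\<dots> = Z \<omega> * (F (W \<omega>) - F a)"
      using integral_FTC_Icc_real[of a "W \<omega>" F D] W_bounds(1)[of \<omega>] DF isCont_D by simp
    finally show ?thesis .
  qed
  have k2: "(\<integral>\<omega>. k \<omega> u \<partial>M) = D u * indicator {a..b} u * (\<integral>\<omega>. Z \<omega> * tau u (W \<omega>) \<partial>M)" for u
  proof -
    have "k \<omega> u = D u * indicator {a..b} u * (Z \<omega> * tau u (W \<omega>))" for \<omega>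
      by (simp add: k_def mult_ac)
    then show ?thesis by simp
  qed
  have fub: "(\<integral>\<omega>. Z \<omega> * (F (W \<omega>) - F a) \<partial>M)
      = (\<integral>u. D u * indicator {a..b} u * (\<integral>\<omega>. Z \<omega> * tau u (W \<omega>) \<partial>M) \<partial>lborel)"
    using P.Fubini_integral[OF k_int] by (simp add: k1 k2)
  have intFa: "integrable M (\<lambda>\<omega>. Z \<omega> * (F (W \<omega>) - F a))"
    using P.integrable_fst'[OF k_int] by (simp add: k1)
  have intF: "integrable M (\<lambda>\<omega>. Z \<omega> * F (W \<omega>))"
    using Bochner_Integration.integrable_add[OF intFa, of "\<lambda>\<omega>. Z \<omega> * F a"] Z
    by (simp add: algebra_simps)
  have int_snd: "integrable lborel (\<lambda>u. D u * indicator {a..b} u * (\<integral>\<omega>. Z \<omega> * tau u (W \<omega>) \<partial>M))"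
    using P.integrable_snd[OF k_int] by (simp add: k2)
  have ZFB: "\<bar>Z \<omega>\<bar> * \<bar>B (W \<omega>) - F (W \<omega>)\<bar> \<le> \<epsilon> * \<bar>Z \<omega>\<bar>" for \<omega>
    using mult_left_mono[OF FB[of "W \<omega>"], of "\<bar>Z \<omega>\<bar>"] by (simp add: mult.commute)
  have intdiff: "integrable M (\<lambda>\<omega>. Z \<omega> * (B (W \<omega>) - F (W \<omega>)))"
    by (rule Bochner_Integration.integrable_bound[OF integrable_mult_right[OF Z(1), of \<epsilon>]])
       (use ZFB eps(1) in \<open>auto simp: abs_mult\<close>)
  have intB: "integrable M (\<lambda>\<omega>. Z \<omega> * B (W \<omega>))"
    using Bochner_Integration.integrable_add[OF intF intdiff] by (simp add: algebra_simps)
  have "\<bar>(\<integral>\<omega>. Z \<omega> * (B (W \<omega>) - F (W \<omega>)) \<partial>M)\<bar> \<le> (\<integral>\<omega>. \<epsilon> * \<bar>Z \<omega>\<bar> \<partial>M)"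
    using Z by (intro order.trans[OF integral_abs_bound] integral_mono)
       (use ZFB integrable_abs[OF intdiff] in \<open>auto simp: abs_mult\<close>)
  also have "\<dots> \<le> e" using eps by simp
  finally have err: "\<bar>\<integral>\<omega>. Z \<omega> * (B (W \<omega>) - F (W \<omega>)) \<partial>M\<bar> \<le> e" .
  \<comment> \<open>The constant \<open>F a\<close> drops out because \<open>Z\<close> has mean
    zero.\<close>
  have "(\<integral>\<omega>. Z \<omega> * B (W \<omega>) \<partial>M)
      = (\<integral>\<omega>. Z \<omega> * (F (W \<omega>) - F a) \<partial>M) + (\<integral>\<omega>. Z \<omega> * (B (W \<omega>) - F (W \<omega>)) \<partial>M)"
    using Z intF intB by (simp add: right_diff_distrib)
  then have "\<bar>\<integral>\<omega>. Z \<omega> * B (W \<omega>) \<partial>M\<bar> \<le> \<bar>\<integral>\<omega>. Z \<omega> * (F (W \<omega>) - F a) \<partial>M\<bar> + e"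
    using err by linarith
  then have "ennreal \<bar>\<integral>\<omega>. Z \<omega> * B (W \<omega>) \<partial>M\<bar> \<le> ennreal \<bar>\<integral>\<omega>. Z \<omega> * (F (W \<omega>) - F a) \<partial>M\<bar> + ennreal e"
    using \<open>0 < e\<close> by (simp add: ennreal_leI flip: ennreal_plus)
  also have "ennreal \<bar>\<integral>\<omega>. Z \<omega> * (F (W \<omega>) - F a) \<partial>M\<bar>
      \<le> (\<integral>\<^sup>+u. ennreal \<bar>D u * indicator {a..b} u * (\<integral>\<omega>. Z \<omega> * tau u (W \<omega>) \<partial>M)\<bar> \<partial>lborel)"
    using integral_norm_bound_ennreal[OF int_snd] by (simp add: fub)
  also have "\<dots> \<le> (\<integral>\<^sup>+u. ennreal \<bar>\<integral>\<omega>. Z \<omega> * tau u (W \<omega>) \<partial>M\<bar> \<partial>lborel)"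
  proof (intro nn_integral_mono ennreal_leI)
    fix u
    have "\<bar>D u * indicator {a..b} u\<bar> \<le> 1" using D_bound[of u] by (simp split: split_indicator)
    then show "\<bar>D u * indicator {a..b} u * (\<integral>\<omega>. Z \<omega> * tau u (W \<omega>) \<partial>M)\<bar>
        \<le> \<bar>\<integral>\<omega>. Z \<omega> * tau u (W \<omega>) \<partial>M\<bar>"
      unfolding abs_mult by (rule mult_left_le_one_le[rotated 2]) auto
  qed
  finally show "ennreal \<bar>\<integral>\<omega>. Z \<omega> * B (W \<omega>) \<partial>M\<bar>
      \<le> (\<integral>\<^sup>+u. ennreal \<bar>\<integral>\<omega>. Z \<omega> * tau u (W \<omega>) \<partial>M\<bar> \<partial>lborel) + ennreal e"
    by (simp add: add_right_mono)
qed

section \<open>Removal of the boundedness assumption by clamping\<close>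

lemma lipschitz_on_clamp:
  fixes B :: "real \<Rightarrow> real"
  assumes "1-lipschitz_on UNIV B"
  shows "1-lipschitz_on UNIV (\<lambda>x. max (- c) (min c (B x)))"
  unfolding lipschitz_on_def
proof (intro conjI ballI)
  fix x y
  have "\<bar>B x - B y\<bar> \<le> \<bar>x - y\<bar>"
    using lipschitz_onD[OF assms, of x y] by (simp add: dist_real_def)
  then show "dist (max (- c) (min c (B x))) (max (- c) (min c (B y))) \<le> 1 * dist x y"
    by (auto simp: dist_real_def max_def min_def)
qed simp

lemma tendsto_clamp: "(\<lambda>n. max (- real n) (min (real n) x)) \<longlonglongrightarrow> x"
proof (rule tendsto_eventually)
  have "max (- real n) (min (real n) x) = x" if "nat \<lceil>\<bar>x\<bar>\<rceil> \<le> n" for n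
    using that by (auto simp: max_def min_def nat_le_iff ceiling_le_iff)
  then show "\<forall>\<^sub>F n in sequentially. max (- real n) (min (real n) x) = x"
    unfolding eventually_sequentially by blast
qed

text \<open>Clamping the values of \<open>B\<close> before those of \<open>W\<close> keeps every integrand dominated, so that no
  boundary terms have to be controlled.\<close>

lemma lipschitz_integral_bound:
  fixes Z W :: "'a \<Rightarrow> real" and B :: "real \<Rightarrow> real"
  assumes "prob_space M" and Z: "integrable M Z" "(\<integral>\<omega>. Z \<omega> \<partial>M) = 0"
    and W [measurable]: "W \<in> borel_measurable M"
    and lip: "1-lipschitz_on UNIV B" and ZB: "integrable M (\<lambda>\<omega>. Z \<omega> * B (W \<omega>))"
  shows "ennreal \<bar>\<integral>\<omega>. Z \<omega> * B (W \<omega>) \<partial>M\<bar>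
           \<le> (\<integral>\<^sup>+u. ennreal \<bar>\<integral>\<omega>. Z \<omega> * tau u (W \<omega>) \<partial>M\<bar> \<partial>lborel)" (is "_ \<le> ?R")
proof -
  have [measurable]: "Z \<in> borel_measurable M" using Z by simp
  have meas: "f \<in> borel_measurable borel" if "1-lipschitz_on UNIV f" for f :: "real \<Rightarrow> real"
    using that by (intro borel_measurable_continuous_onI lipschitz_on_continuous_on)
  have [measurable]: "B \<in> borel_measurable borel" using lip by (rule meas)
  define cl where "cl n x = max (- real n) (min (real n) x)" for n x
  have [measurable]: "cl n \<in> borel_measurable borel" for n unfolding cl_def by measurable
  have cl_lim: "(\<lambda>n. cl n x) \<longlonglongrightarrow> x" for x unfolding cl_def by (rule tendsto_clamp)
  have cl_abs: "\<bar>cl n x\<bar> \<le> \<bar>x\<bar>" "\<bar>cl n x\<bar> \<le> real n" for n x by (auto simp: cl_def max_def min_def)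
  \<comment> \<open>With the values of \<open>B\<close> clamped to \<open>[-m, m]\<close>, the bound
    \<open>m * \<bar>Z\<bar>\<close> dominates, so the clamp on \<open>W\<close> can be released by
    letting \<open>n\<close> grow while \<open>m\<close> stays fixed.\<close>
  have bounded_case: "ennreal \<bar>\<integral>\<omega>. Z \<omega> * cl m (B (W \<omega>)) \<partial>M\<bar> \<le> ?R" for m
  proof (rule LIMSEQ_le_const2)
    have cont: "isCont (\<lambda>x. cl m (B x)) x" for x
      using lipschitz_on_continuous_on[OF lipschitz_on_clamp[OF lip]]
      by (simp add: cl_def continuous_on_eq_continuous_at)
    have "(\<lambda>n. \<integral>\<omega>. Z \<omega> * cl m (B (cl n (W \<omega>))) \<partial>M) \<longlonglongrightarrow> (\<integral>\<omega>. Z \<omega> * cl m (B (W \<omega>)) \<partial>M)"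
    proof (rule integral_dominated_convergence)
      show "integrable M (\<lambda>\<omega>. real m * \<bar>Z \<omega>\<bar>)" using Z by simp
      show "AE \<omega> in M. (\<lambda>n. Z \<omega> * cl m (B (cl n (W \<omega>)))) \<longlonglongrightarrow> Z \<omega> * cl m (B (W \<omega>))"
        by (intro AE_I2 tendsto_mult tendsto_const isCont_tendsto_compose[OF cont] cl_lim)
      show "AE \<omega> in M. norm (Z \<omega> * cl m (B (cl n (W \<omega>)))) \<le> real m * \<bar>Z \<omega>\<bar>" for n
        by (rule AE_I2) (simp add: abs_mult mult.commute[of "real m"] mult_left_mono cl_abs)
    qed measurable
    then show "(\<lambda>n. ennreal \<bar>\<integral>\<omega>. Z \<omega> * cl m (B (cl n (W \<omega>))) \<partial>M\<bar>)
        \<longlonglongrightarrow> ennreal \<bar>\<integral>\<omega>. Z \<omega> * cl m (B (W \<omega>)) \<partial>M\<bar>"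
      by (intro tendsto_ennrealI tendsto_rabs)
    have "ennreal \<bar>\<integral>\<omega>. Z \<omega> * cl m (B (cl n (W \<omega>))) \<partial>M\<bar> \<le> ?R" for n
    proof -
      have "ennreal \<bar>\<integral>\<omega>. Z \<omega> * cl m (B (cl n (W \<omega>))) \<partial>M\<bar>
          \<le> (\<integral>\<^sup>+u. ennreal \<bar>\<integral>\<omega>. Z \<omega> * tau u (cl n (W \<omega>)) \<partial>M\<bar> \<partial>lborel)"
        by (rule lipschitz_integral_bound_bounded[OF assms(1) Z, where a = "- real n" and b = n])
           (use lip in \<open>auto simp: cl_def intro!: lipschitz_on_clamp\<close>)
      also have "\<dots> \<le> ?R"
      proof (intro nn_integral_mono ennreal_leI)
        fix u
        \<comment> \<open>Clamping \<open>W\<close> changes the event \<open>W > u\<close> only for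
          levels outside \<open>[-n, n)\<close>. There the event becomes empty or certain, and its
          integral against the centred \<open>Z\<close> is 0.\<close>
        consider "real n \<le> u" | "u < - real n" | "- real n \<le> u" "u < real n" by linarith
        then show "\<bar>\<integral>\<omega>. Z \<omega> * tau u (cl n (W \<omega>)) \<partial>M\<bar> \<le> \<bar>\<integral>\<omega>. Z \<omega> * tau u (W \<omega>) \<partial>M\<bar>"
        proof cases
          case 1
          then have "tau u (cl n (W \<omega>)) = 0" for \<omega> by (auto simp: tau_def cl_def)
          then show ?thesis by simp
        next
          case 2
          then have "tau u (cl n (W \<omega>)) = 1" for \<omega> by (auto simp: tau_def cl_def)
          then show ?thesis using Z by simp
        next
          case 3
          then have "tau u (cl n (W \<omega>)) = tau u (W \<omega>)" for \<omega>
            by (auto simp: tau_def cl_def)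
          then show ?thesis by simp
        qed
      qed
      finally show ?thesis .
    qed
    then show "\<exists>N. \<forall>n\<ge>N. ennreal \<bar>\<integral>\<omega>. Z \<omega> * cl m (B (cl n (W \<omega>))) \<partial>M\<bar> \<le> ?R" by blast
  qed
  show ?thesis
  proof (rule LIMSEQ_le_const2)
    \<comment> \<open>Clamping never increases absolute values, so the integrable product
      \<open>Z * B(W)\<close> itself dominates.\<close>
    have "(\<lambda>m. \<integral>\<omega>. Z \<omega> * cl m (B (W \<omega>)) \<partial>M) \<longlonglongrightarrow> (\<integral>\<omega>. Z \<omega> * B (W \<omega>) \<partial>M)"
    proof (rule integral_dominated_convergence)
      show "integrable M (\<lambda>\<omega>. \<bar>Z \<omega> * B (W \<omega>)\<bar>)" using ZB by simp
      show "AE \<omega> in M. (\<lambda>m. Z \<omega> * cl m (B (W \<omega>))) \<longlonglongrightarrow> Z \<omega> * B (W \<omega>)"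
        by (intro AE_I2 tendsto_mult tendsto_const cl_lim)
      show "AE \<omega> in M. norm (Z \<omega> * cl m (B (W \<omega>))) \<le> \<bar>Z \<omega> * B (W \<omega>)\<bar>" for m
        by (simp add: abs_mult mult_left_mono cl_abs)
    qed measurable
    then show "(\<lambda>m. ennreal \<bar>\<integral>\<omega>. Z \<omega> * cl m (B (W \<omega>)) \<partial>M\<bar>)
        \<longlonglongrightarrow> ennreal \<bar>\<integral>\<omega>. Z \<omega> * B (W \<omega>) \<partial>M\<bar>"
      by (intro tendsto_ennrealI tendsto_rabs)
  qed (use bounded_case in blast)
qed

section \<open>Quantile transform of the interior Stieltjes integral\<close>

lemma mono_tendsto_at_right:
  fixes v :: "real \<Rightarrow> real"
  assumes "mono v"
  shows "(v \<longlongrightarrow> (INF t\<in>{y<..}. v t)) (at_right y)"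
proof (rule order_tendstoI)
  have bdd: "bdd_below (v ` {y<..})"
    using \<open>mono v\<close> by (intro bdd_belowI2[of _ "v y"]) (auto intro: monoD)
  show "\<forall>\<^sub>F x in at_right y. a < v x" if "a < (INF t\<in>{y<..}. v t)" for a
    using that cINF_lower[OF bdd]
    by (intro eventually_at_rightI[of y "y + 1"]) (auto intro: less_le_trans)
  fix a assume "(INF t\<in>{y<..}. v t) < a"
  then obtain t where "y < t" "v t < a"
    using cINF_less_iff[OF _ bdd] by auto
  then show "\<forall>\<^sub>F x in at_right y. v x < a"
    by (intro eventually_at_rightI[of y t]) (auto intro: le_less_trans[OF monoD[OF \<open>mono v\<close>, of _ t]])
qed

lemma mono_tendsto_at_left:
  fixes v :: "real \<Rightarrow> real"
  assumes "mono v"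
  shows "(v \<longlongrightarrow> (SUP t\<in>{..<y}. v t)) (at_left y)"
proof (rule order_tendstoI)
  have bdd: "bdd_above (v ` {..<y})"
    using \<open>mono v\<close> by (intro bdd_aboveI2[of _ _ "v y"]) (auto intro: monoD)
  show "\<forall>\<^sub>F x in at_left y. v x < a" if "(SUP t\<in>{..<y}. v t) < a" for a
    using that cSUP_upper[OF _ bdd]
    by (intro eventually_at_leftI[of "y - 1" y]) (auto intro: le_less_trans)
  fix a assume "a < (SUP t\<in>{..<y}. v t)"
  then obtain t where "t < y" "a < v t"
    using less_cSUP_iff[OF _ bdd] by auto
  then show "\<forall>\<^sub>F x in at_left y. a < v x"
    by (intro eventually_at_leftI[of t y]) (auto intro: less_le_trans[OF _ monoD[OF \<open>mono v\<close>, of t]])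
qed

text \<open>The universal properties of the infimum and supremum that the one-sided limits are;
  later arguments use only these inequalities.\<close>

lemma
  fixes v :: "real \<Rightarrow> real"
  assumes "mono v"
  shows Lim_at_right_le: "y < t \<Longrightarrow> Lim (at_right y) v \<le> v t"
    and le_Lim_at_right: "(\<And>t. y < t \<Longrightarrow> c \<le> v t) \<Longrightarrow> c \<le> Lim (at_right y) v"
    and le_Lim_at_left: "t < y \<Longrightarrow> v t \<le> Lim (at_left y) v"
    and Lim_at_left_le: "(\<And>t. t < y \<Longrightarrow> v t \<le> c) \<Longrightarrow> Lim (at_left y) v \<le> c"
proof -
  have R: "Lim (at_right y) v = (INF t\<in>{y<..}. v t)"
    by (intro tendsto_Lim mono_tendsto_at_right assms) simp
  have L: "Lim (at_left y) v = (SUP t\<in>{..<y}. v t)"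
    by (intro tendsto_Lim mono_tendsto_at_left assms) simp
  show "y < t \<Longrightarrow> Lim (at_right y) v \<le> v t" unfolding R
    by (rule cINF_lower) (auto intro!: bdd_belowI2[of _ "v y"] monoD[OF assms])
  show "(\<And>t. y < t \<Longrightarrow> c \<le> v t) \<Longrightarrow> c \<le> Lim (at_right y) v" unfolding R
    by (rule cINF_greatest) auto
  show "t < y \<Longrightarrow> v t \<le> Lim (at_left y) v" unfolding L
    by (rule cSUP_upper) (auto intro!: bdd_aboveI2[of _ _ "v y"] monoD[OF assms])
  show "(\<And>t. t < y \<Longrightarrow> v t \<le> c) \<Longrightarrow> Lim (at_left y) v \<le> c" unfolding L
    by (rule cSUP_least) auto
qed

text \<open>The last two properties, monotonicity and right-continuity of the right limit, are what
  \<open>interval_measure\<close> requires in order to give \<open>{a<..b}\<close> the increment of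
  that limit as its mass.\<close>

lemma
  fixes v :: "real \<Rightarrow> real"
  assumes "mono v"
  shows le_Lim_at_right_self: "v y \<le> Lim (at_right y) v"
    and Lim_at_left_le_self: "Lim (at_left y) v \<le> v y"
    and Lim_at_right_mono: "x \<le> y \<Longrightarrow> Lim (at_right x) v \<le> Lim (at_right y) v"
    and continuous_Lim_at_right: "continuous (at_right y) (\<lambda>x. Lim (at_right x) v)"
proof -
  show "v y \<le> Lim (at_right y) v"
    using assms by (intro le_Lim_at_right) (auto intro: monoD)
  show "Lim (at_left y) v \<le> v y"
    using assms by (intro Lim_at_left_le) (auto intro: monoD)
  show R_mono: "x \<le> y \<Longrightarrow> Lim (at_right x) v \<le> Lim (at_right y) v" for x y
    using assms by (intro le_Lim_at_right) (auto intro: Lim_at_right_le)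
  show "continuous (at_right y) (\<lambda>x. Lim (at_right x) v)"
    unfolding continuous_within
  proof (rule order_tendstoI)
    show "\<forall>\<^sub>F x in at_right y. a < Lim (at_right x) v" if "a < Lim (at_right y) v" for a
      using that R_mono by (intro eventually_at_rightI[of y "y + 1"]) (auto intro: less_le_trans)
    fix a assume "Lim (at_right y) v < a"
    then obtain t where "y < t" "v t < a"
      using le_Lim_at_right[OF assms, of y a] by (auto simp: not_le[symmetric])
    then show "\<forall>\<^sub>F x in at_right y. Lim (at_right x) v < a"
      by (intro eventually_at_rightI[of y t])
         (auto intro: le_less_trans[OF Lim_at_right_le[OF assms]])
  qed
qed

lemma countable_Lim_neq:
  fixes v :: "real \<Rightarrow> real"
  assumes "mono v"
  shows "countable {y. Lim (at_left y) v \<noteq> Lim (at_right y) v}"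
proof (rule countable_subset[OF _ mono_ctble_discont[OF assms]])
  have "Lim (at_left y) v = v y" "Lim (at_right y) v = v y" if "isCont v y" for y
    using that by (auto intro!: tendsto_Lim simp: isCont_def filterlim_at_split)
  then show "{y. Lim (at_left y) v \<noteq> Lim (at_right y) v} \<subseteq> {y. \<not> isCont v y}"
    by auto
qed

text \<open>The set of levels \<open>u\<close> for which the upward closed set \<open>{t. u < v t}\<close> is a proper half-line,
  and the endpoint of that half-line.\<close>

definition levels :: "(real \<Rightarrow> real) \<Rightarrow> real set" where
  "levels v = {u. (\<exists>t. u < v t) \<and> (\<exists>t. v t \<le> u)}"

definition quantile :: "(real \<Rightarrow> real) \<Rightarrow> real \<Rightarrow> real" where
  "quantile v u = (if u \<in> levels v then Inf {t. u < v t} else 0)"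

text \<open>Both inequalities are strict on the side of \<open>t\<close>: at the endpoint itself
  \<open>v\<close> may lie on either side of \<open>u\<close>, depending on its value at the
  jump.\<close>

lemma
  assumes "mono v" "u \<in> levels v"
  shows less_quantileD: "t < quantile v u \<Longrightarrow> v t \<le> u"
    and quantile_lessD: "quantile v u < t \<Longrightarrow> u < v t"
proof -
  obtain t0 t1 where t: "v t0 \<le> u" "u < v t1"
    using assms(2) by (auto simp: levels_def)
  have bdd: "bdd_below {t. u < v t}"
  proof (rule bdd_belowI)
    fix t assume "t \<in> {t. u < v t}"
    then show "t0 \<le> t"
      using t(1) monoD[OF assms(1), of t t0] by (intro leI notI) simp
  qed
  have Q: "quantile v u = Inf {t. u < v t}"
    using assms(2) by (simp add: quantile_def)
  show "t < quantile v u \<Longrightarrow> v t \<le> u"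
    unfolding Q using cInf_lower[OF _ bdd, of t] by (intro leI notI) auto
  assume "quantile v u < t"
  then obtain s where "u < v s" "s < t"
    unfolding Q using cInf_less_iff[OF _ bdd] t by auto
  then show "u < v t"
    using monoD[OF assms(1), of s t] by simp
qed

text \<open>All points other than the endpoint are already classified; whether
  \<open>u < v (quantile v u)\<close> decides if the half-line is closed or open.\<close>

lemma levels_half_line:
  fixes v :: "real \<Rightarrow> real"
  assumes "mono v" "u \<in> levels v"
  shows "{t. u < v t} = {quantile v u<..} \<or> {t. u < v t} = {quantile v u..}"
proof (cases "u < v (quantile v u)")
  case True
  then have "u < v t \<longleftrightarrow> quantile v u \<le> t" for t
    using less_quantileD[OF assms, of t] quantile_lessD[OF assms, of t]
    by (cases t "quantile v u" rule: linorder_cases) auto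
  then show ?thesis by auto
next
  case False
  then have "u < v t \<longleftrightarrow> quantile v u < t" for t
    using less_quantileD[OF assms, of t] quantile_lessD[OF assms, of t]
    by (cases t "quantile v u" rule: linorder_cases) auto
  then show ?thesis by auto
qed

lemma quantile_eqI:
  assumes "mono v" "\<And>t. t < y \<Longrightarrow> v t \<le> u" "\<And>t. y < t \<Longrightarrow> u < v t"
  shows "u \<in> levels v \<and> quantile v u = y"
proof
  show *: "u \<in> levels v"
    using assms(2)[of "y - 1"] assms(3)[of "y + 1"] by (auto simp: levels_def)
  show "quantile v u = y"
  proof (rule ccontr)
    assume "quantile v u \<noteq> y"
    then consider "quantile v u < y" | "y < quantile v u" by linarith
    then show False
    proof cases
      case 1
      then obtain t where "quantile v u < t" "t < y" using dense by blast
      then show False using assms(2)[of t] quantile_lessD[OF assms(1) *, of t] by simp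
    next
      case 2
      then obtain t where "t < quantile v u" "y < t" using dense by blast
      then show False using assms(3)[of t] less_quantileD[OF assms(1) *, of t] by simp
    qed
  qed
qed

lemma quantile_bounds:
  assumes "mono v" "u \<in> levels v"
  shows "Lim (at_left (quantile v u)) v \<le> u" "u \<le> Lim (at_right (quantile v u)) v"
proof -
  show "Lim (at_left (quantile v u)) v \<le> u"
    using assms(1) less_quantileD[OF assms] by (rule Lim_at_left_le)
  show "u \<le> Lim (at_right (quantile v u)) v"
    using assms(1) less_imp_le[OF quantile_lessD[OF assms]] by (rule le_Lim_at_right)
qed

text \<open>A jump of \<open>v\<close> at \<open>y\<close> is a flat piece of the generalised
  inverse: all levels strictly inside the gap are sent to \<open>y\<close>.\<close>

lemma quantile_eq_between:
  assumes "mono v" "Lim (at_left y) v < u" "u < Lim (at_right y) v"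
  shows "u \<in> levels v \<and> quantile v u = y"
  by (rule quantile_eqI)
     (use assms in \<open>auto dest: le_Lim_at_left[OF assms(1)] Lim_at_right_le[OF assms(1)]\<close>)

section \<open>Measurability of the quantile and its image measure\<close>

lemma levels_borel:
  assumes "mono v"
  shows "levels v \<in> sets borel"
proof -
  have "levels v = (\<Union>n. {..<v (real n)}) \<inter> (\<Union>n. {v (- real n)..})"
  proof safe
    fix u assume "u \<in> levels v"
    then obtain t0 t1 where t: "v t0 \<le> u" "u < v t1"
      by (auto simp: levels_def)
    obtain n0 where "- t0 \<le> real n0" using real_arch_simple[of "- t0"] ..
    then show "u \<in> (\<Union>n. {v (- real n)..})"
      using t(1) monoD[OF assms, of "- real n0" t0] by (intro UN_I[of n0]) auto
    obtain n1 where "t1 \<le> real n1" using real_arch_simple[of t1] ..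
    then show "u \<in> (\<Union>n. {..<v (real n)})"
      using t(2) monoD[OF assms, of t1 "real n1"] by (intro UN_I[of n1]) auto
  qed (auto simp: levels_def)
  then show ?thesis by simp
qed

text \<open>The quantile is non-decreasing on the Borel set \<open>levels v\<close> and constant off
  it.\<close>

lemma measurable_quantile:
  assumes "mono v"
  shows "quantile v \<in> borel_measurable borel"
proof -
  have "mono_on (levels v) (\<lambda>u. Inf {t. u < v t})"
  proof (rule mono_onI)
    fix r s assume rs: "r \<in> levels v" "s \<in> levels v" "r \<le> s"
    have "quantile v r \<le> quantile v s"
    proof (rule ccontr)
      assume "\<not> quantile v r \<le> quantile v s"
      then obtain t where "quantile v s < t" "t < quantile v r" using dense by (auto simp: not_le)
      then show False
        using less_quantileD[OF assms rs(1)] quantile_lessD[OF assms rs(2)] rs(3) by fastforce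
    qed
    then show "Inf {t. r < v t} \<le> Inf {t. s < v t}" using rs by (simp add: quantile_def)
  qed
  then have "(\<lambda>u. Inf {t. u < v t}) \<in> borel_measurable (restrict_space borel (levels v))"
    by (rule borel_measurable_mono_on_fnc)
  then have "(\<lambda>u. if u \<in> levels v then Inf {t. u < v t} else 0) \<in> borel_measurable borel"
    using levels_borel[OF assms] by (subst (asm) measurable_restrict_space_iff[where c = 0]) auto
  then show ?thesis by (simp add: quantile_def[abs_def])
qed

text \<open>The levels with quantile in \<open>{a<..b}\<close> form, up to endpoints, the interval
  between the right limits of \<open>v\<close> at \<open>a\<close> and at \<open>b\<close>.
  Half-open intervals are stable under intersection and generate the Borel sets, so agreement on
  them suffices.\<close>

lemma stieltjes_measure_eq_distr:
  assumes "mono v"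
  shows "stieltjes_measure v = distr (restrict_space lborel (levels v)) borel (quantile v)"
    (is "_ = ?D")
proof -
  let ?R = "\<lambda>y. Lim (at_right y) v"
  let ?E = "range (\<lambda>(a, b). {a<..b::real})"
  note [measurable] = measurable_quantile[OF assms] levels_borel[OF assms]
  have *: "emeasure (stieltjes_measure v) {a<..b} = (if a \<le> b then ennreal (?R b - ?R a) else 0)" for a b
    unfolding stieltjes_measure_def
    using emeasure_interval_measure_Ioc_eq[of ?R a b] assms
    by (simp add: Lim_at_right_mono continuous_Lim_at_right)
  have D: "emeasure ?D {a<..b} = emeasure lborel {u \<in> levels v. a < quantile v u \<and> quantile v u \<le> b}" for a b
  proof -
    have "emeasure ?D {a<..b}
        = emeasure (restrict_space lborel (levels v)) (quantile v -` {a<..b} \<inter> levels v)"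
      by (subst emeasure_distr) (auto simp: space_restrict_space intro!: measurable_restrict_space1)
    also have "\<dots> = emeasure lborel (quantile v -` {a<..b} \<inter> levels v)"
      by (rule emeasure_restrict_space) auto
    also have "quantile v -` {a<..b} \<inter> levels v = {u \<in> levels v. a < quantile v u \<and> quantile v u \<le> b}"
      by auto
    finally show ?thesis .
  qed
  have eq: "emeasure (stieltjes_measure v) {a<..b} = emeasure ?D {a<..b}" for a b
  proof (cases "a \<le> b")
    case True
    let ?T = "{u \<in> levels v. a < quantile v u \<and> quantile v u \<le> b}"
    have le: "?R a \<le> ?R b" using assms True by (rule Lim_at_right_mono)
    \<comment> \<open>Sandwich between an open and a closed interval of equal Lebesgue measure, so
      the endpoint levels never have to be located.\<close>
    have lower: "{?R a<..<?R b} \<subseteq> ?T"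
    proof
      fix u assume "u \<in> {?R a<..<?R b}"
      then have u: "?R a < u" "u < ?R b" by auto
      \<comment> \<open>The right limit is an infimum, so a level strictly above it exceeds
        \<open>v\<close> at some \<open>t > a\<close>; this puts the quantile strictly to the right
        of \<open>a\<close>.\<close>
      then obtain t where t: "a < t" "v t < u"
        using le_Lim_at_right[OF assms, of a u] by (auto simp: not_le[symmetric])
      have *: "u < v s" if "b < s" for s
        using Lim_at_right_le[OF assms that] u by simp
      have S: "u \<in> levels v"
        using t *[of "b + 1"] by (auto simp: levels_def intro: less_imp_le)
      have "t \<le> quantile v u"
        using quantile_lessD[OF assms S, of t] t by (intro leI notI) simp
      moreover have "quantile v u \<le> b"
      proof (rule ccontr)
        assume "\<not> quantile v u \<le> b"
        then obtain s where "b < s" "s < quantile v u" using dense by (auto simp: not_le)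
        then show False using *[of s] less_quantileD[OF assms S, of s] by simp
      qed
      ultimately show "u \<in> ?T" using S t by simp
    qed
    have upper: "?T \<subseteq> {?R a..?R b}"
    proof
      fix u assume "u \<in> ?T"
      then have u: "u \<in> levels v" "a < quantile v u" "quantile v u \<le> b" by auto
      have "u \<le> ?R b"
        using quantile_bounds(2)[OF assms u(1)] Lim_at_right_mono[OF assms u(3)] by simp
      moreover obtain t where "a < t" "t < quantile v u" using u(2) dense by blast
      then have "?R a \<le> u"
        using Lim_at_right_le[OF assms, of a t] less_quantileD[OF assms u(1), of t] by simp
      ultimately show "u \<in> {?R a..?R b}" by simp
    qed
    have "emeasure lborel {?R a<..<?R b} \<le> emeasure lborel ?T"
      by (rule emeasure_mono[OF lower]) simp
    moreover have "emeasure lborel ?T \<le> emeasure lborel {?R a..?R b}"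
      by (rule emeasure_mono[OF upper]) simp
    ultimately show ?thesis using * D le True by (simp add: antisym)
  next
    case False then show ?thesis by simp
  qed
  show ?thesis
  proof (rule measure_eqI_generator_eq[where E = ?E and \<Omega> = UNIV and A = "\<lambda>n. {- real n<..real n}"])
    have "\<exists>c d. {a<..b} \<inter> {a'<..b'} = {c<..d}" for a b a' b' :: real
      by (intro exI[of _ "max a a'"] exI[of _ "min b b'"]) auto
    then show "Int_stable ?E"
      by (auto simp: Int_stable_def image_iff)
    show "sets (stieltjes_measure v) = sigma_sets UNIV ?E" "sets ?D = sigma_sets UNIV ?E"
      by (simp_all add: stieltjes_measure_def borel_sigma_sets_Ioc)
    show "(\<Union>n. {- real n<..real n}) = UNIV"
    proof safe
      fix x :: real
      obtain n where "\<bar>x\<bar> < real n" using reals_Archimedean2 by blast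
      then show "x \<in> (\<Union>n. {- real n<..real n})" by (intro UN_I[of n]) auto
    qed simp
    show "emeasure (stieltjes_measure v) X = emeasure ?D X" if "X \<in> ?E" for X
      using that eq by auto
    show "emeasure (stieltjes_measure v) {- real n<..real n} \<noteq> \<infinity>" for n
      using * by simp
  qed auto
qed

text \<open>Isolates the fibres of \<open>Q\<close> over \<open>J\<close>, so that an integrand can
  be redistributed inside each fibre. Countability of \<open>J\<close> allows the sum and the
  integral to be interchanged.\<close>

lemma nn_integral_split_countable_values:
  assumes [measurable]: "\<phi> \<in> borel_measurable M" "S \<in> sets M" "Q \<in> borel_measurable M"
    and J: "countable (J :: real set)"
  shows "(\<integral>\<^sup>+u. \<phi> u * indicator S u \<partial>M) = (\<integral>\<^sup>+u. \<phi> u * indicator {u \<in> S. Q u \<notin> J} u \<partial>M)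
    + (\<integral>\<^sup>+y. (\<integral>\<^sup>+u. \<phi> u * indicator {u \<in> S. Q u = y} u \<partial>M) \<partial>count_space J)"
proof -
  have [measurable]: "J \<in> sets borel" using J by (rule sets.countable[rotated]) auto
  have SM: "u \<in> space M" if "u \<in> S" for u using that sets.sets_into_space[of S M] by auto
  have [measurable]: "{u \<in> S. Q u \<notin> J} \<in> sets M"  "{u \<in> S. Q u = y} \<in> sets M" for y
    using SM by measurable
  \<comment> \<open>For fixed \<open>u\<close> at most one index contributes, namely
    \<open>y = Q u\<close>.\<close>
  have pt: "(\<integral>\<^sup>+y. \<phi> u * indicator {u \<in> S. Q u = y} u \<partial>count_space J)
      = \<phi> u * indicator {u \<in> S. Q u \<in> J} u" for u
  proof (cases "u \<in> S \<and> Q u \<in> J")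
    case True
    have "(\<integral>\<^sup>+y. \<phi> u * indicator {u \<in> S. Q u = y} u \<partial>count_space J)
        = (\<integral>\<^sup>+y. \<phi> u * indicator {Q u} y \<partial>count_space J)"
      using True by (intro nn_integral_cong) (auto split: split_indicator)
    then show ?thesis using True by (simp add: nn_integral_cmult)
  next
    case False
    then have "(\<integral>\<^sup>+y. \<phi> u * indicator {u \<in> S. Q u = y} u \<partial>count_space J) = (\<integral>\<^sup>+y. 0 \<partial>count_space J)"
      by (intro nn_integral_cong) (auto split: split_indicator)
    then show ?thesis using False by (auto split: split_indicator)
  qed
  have "(\<integral>\<^sup>+u. \<phi> u * indicator S u \<partial>M)
      = (\<integral>\<^sup>+u. \<phi> u * indicator {u \<in> S. Q u \<notin> J} u
            + (\<integral>\<^sup>+y. \<phi> u * indicator {u \<in> S. Q u = y} u \<partial>count_space J) \<partial>M)"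
    unfolding pt by (intro nn_integral_cong) (auto split: split_indicator)
  also have "\<dots> = (\<integral>\<^sup>+u. \<phi> u * indicator {u \<in> S. Q u \<notin> J} u \<partial>M)
      + (\<integral>\<^sup>+u. (\<integral>\<^sup>+y. \<phi> u * indicator {u \<in> S. Q u = y} u \<partial>count_space J) \<partial>M)"
  proof (rule nn_integral_add)
    have "{u \<in> S. Q u \<in> J} \<in> sets M" using SM by measurable
    then show "(\<lambda>u. \<integral>\<^sup>+y. \<phi> u * indicator {u \<in> S. Q u = y} u \<partial>count_space J) \<in> borel_measurable M"
      unfolding pt by measurable
  qed measurable
  also have "(\<integral>\<^sup>+u. (\<integral>\<^sup>+y. \<phi> u * indicator {u \<in> S. Q u = y} u \<partial>count_space J) \<partial>M)
      = (\<integral>\<^sup>+y. (\<integral>\<^sup>+u. \<phi> u * indicator {u \<in> S. Q u = y} u \<partial>M) \<partial>count_space J)"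
    by (rule nn_integral_count_space_nn_integral[OF J]) measurable
  finally show ?thesis .
qed

text \<open>At levels whose quantile is not a jump the integrands agree pointwise. Over a jump they
  differ, but have the same integral: the average weights the one-sided limits of \<open>f\<close>
  by the lengths of the level intervals on which \<open>g\<close> takes these values.\<close>

lemma stieltjes_nn_integral_eq_quantile:
  assumes v: "mono v"
    and [measurable]: "f \<in> borel_measurable borel" "g \<in> borel_measurable borel"
    and nonneg: "\<And>y. 0 \<le> Lim (at_left y) f" "\<And>y. 0 \<le> Lim (at_right y) f"
    and g_cont: "\<And>u. u \<in> levels v \<Longrightarrow>
        Lim (at_left (quantile v u)) v = Lim (at_right (quantile v u)) v \<Longrightarrow> g u = f (quantile v u)"
    and g_left: "\<And>y u. Lim (at_left y) v < u \<Longrightarrow> u < v y \<Longrightarrow> g u = Lim (at_left y) f"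
    and g_right: "\<And>y u. v y < u \<Longrightarrow> u < Lim (at_right y) v \<Longrightarrow> g u = Lim (at_right y) f"
  shows "stieltjes_nn_integral f v = (\<integral>\<^sup>+u. ennreal (g u) * indicator (levels v) u \<partial>lborel)"
proof -
  note [measurable] = measurable_quantile[OF v] levels_borel[OF v]
  let ?L = "\<lambda>y. Lim (at_left y) v" and ?R = "\<lambda>y. Lim (at_right y) v"
  let ?S = "levels v" and ?Q = "quantile v"
  define J where "J = {y. ?L y \<noteq> ?R y}"
  have J: "countable J" unfolding J_def using v by (rule countable_Lim_neq)
  \<comment> \<open>The jump average differs from \<open>f\<close> at most on the countable set of
    jumps.\<close>
  have [measurable]: "jump_average f v \<in> borel_measurable borel"
    by (rule measurable_discrete_difference[OF _ J, of f])
       (auto simp: J_def jump_average_def)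
  have "stieltjes_nn_integral f v = (\<integral>\<^sup>+u. ennreal (jump_average f v (?Q u)) * indicator ?S u \<partial>lborel)"
    unfolding stieltjes_nn_integral_def stieltjes_measure_eq_distr[OF v]
    by (subst nn_integral_distr)
       (auto intro!: measurable_restrict_space1 simp: nn_integral_restrict_space)
  also have "\<dots> = (\<integral>\<^sup>+u. ennreal (jump_average f v (?Q u)) * indicator {u \<in> ?S. ?Q u \<notin> J} u \<partial>lborel)
      + (\<integral>\<^sup>+y. (\<integral>\<^sup>+u. ennreal (jump_average f v (?Q u)) * indicator {u \<in> ?S. ?Q u = y} u \<partial>lborel) \<partial>count_space J)"
    by (rule nn_integral_split_countable_values[OF _ _ _ J]) auto
  also have "(\<integral>\<^sup>+u. ennreal (jump_average f v (?Q u)) * indicator {u \<in> ?S. ?Q u \<notin> J} u \<partial>lborel)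
      = (\<integral>\<^sup>+u. ennreal (g u) * indicator {u \<in> ?S. ?Q u \<notin> J} u \<partial>lborel)"
    by (intro nn_integral_cong) (auto simp: J_def jump_average_def g_cont split: split_indicator)
  also have "(\<integral>\<^sup>+y. (\<integral>\<^sup>+u. ennreal (jump_average f v (?Q u)) * indicator {u \<in> ?S. ?Q u = y} u \<partial>lborel) \<partial>count_space J)
      = (\<integral>\<^sup>+y. (\<integral>\<^sup>+u. ennreal (g u) * indicator {u \<in> ?S. ?Q u = y} u \<partial>lborel) \<partial>count_space J)"
  proof (rule nn_integral_cong)
    fix y assume "y \<in> space (count_space J)"
    then have neq: "?L y \<noteq> ?R y" by (simp add: J_def)
    have le: "?L y \<le> v y" "v y \<le> ?R y"
      using v by (rule Lim_at_left_le_self le_Lim_at_right_self)+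
    have lt: "?L y < ?R y" using neq le by simp
    let ?c = "Lim (at_left y) f" and ?d = "Lim (at_right y) f"
    \<comment> \<open>Discarding these three levels avoids deciding whether the ends of the gap
      belong to the fibre over \<open>y\<close>, and which value \<open>g\<close> takes at the level
      \<open>v y\<close>.\<close>
    have ae: "AE u in lborel. u \<noteq> ?L y \<and> u \<noteq> v y \<and> u \<noteq> ?R y"
      using AE_lborel_singleton[of "?L y"] AE_lborel_singleton[of "v y"] AE_lborel_singleton[of "?R y"]
      by eventually_elim simp
    have mem: "u \<in> ?S \<and> ?Q u = y \<longleftrightarrow> ?L y < u \<and> u < ?R y" if "u \<noteq> ?L y" "u \<noteq> ?R y" for u
      using that quantile_eq_between[OF v, of y u] quantile_bounds[OF v, of u] by fastforce
    have "(\<integral>\<^sup>+u. ennreal (jump_average f v (?Q u)) * indicator {u \<in> ?S. ?Q u = y} u \<partial>lborel)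
        = (\<integral>\<^sup>+u. ennreal (jump_average f v y) * indicator {?L y<..<?R y} u \<partial>lborel)"
      using ae
    proof (intro nn_integral_cong_AE, eventually_elim)
      case (elim u)
      then show ?case using mem[of u] by (cases "?L y < u \<and> u < ?R y") (auto simp: indicator_def)
    qed
    also have "\<dots> = ennreal (jump_average f v y * (?R y - ?L y))"
      using lt by (subst nn_integral_cmult_indicator) (simp_all add: ennreal_mult'')
    \<comment> \<open>The length of the gap cancels the denominator of the average.\<close>
    also have "jump_average f v y * (?R y - ?L y) = ?c * (v y - ?L y) + ?d * (?R y - v y)"
      using neq by (simp add: jump_average_def Let_def mult.commute)
    also have "ennreal \<dots> = (\<integral>\<^sup>+u. ennreal ?c * indicator {?L y<..<v y} u + ennreal ?d * indicator {v y<..<?R y} u \<partial>lborel)"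
      using nonneg[of y] le
      by (subst nn_integral_add) (simp_all add: nn_integral_cmult_indicator ennreal_plus ennreal_mult)
    also have "\<dots> = (\<integral>\<^sup>+u. ennreal (g u) * indicator {u \<in> ?S. ?Q u = y} u \<partial>lborel)"
      using ae
    proof (intro nn_integral_cong_AE, eventually_elim)
      case (elim u)
      consider "?L y < u" "u < v y" | "v y < u" "u < ?R y" | "u < ?L y" | "?R y < u"
        using elim by linarith
      then show ?case
      proof cases
        case 1 then show ?thesis using le mem[of u] elim g_left[of y u] by (simp add: indicator_def)
      next
        case 2 then show ?thesis using le mem[of u] elim g_right[of y u] by (simp add: indicator_def)
      next
        case 3 then show ?thesis using le mem[of u] elim by (auto simp add: indicator_def)
      next
        case 4 then show ?thesis using le mem[of u] elim by (auto simp add: indicator_def)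
      qed
    qed
    finally show "(\<integral>\<^sup>+u. ennreal (jump_average f v (?Q u)) * indicator {u \<in> ?S. ?Q u = y} u \<partial>lborel)
        = (\<integral>\<^sup>+u. ennreal (g u) * indicator {u \<in> ?S. ?Q u = y} u \<partial>lborel)" .
  qed
  also have "(\<integral>\<^sup>+u. ennreal (g u) * indicator {u \<in> ?S. ?Q u \<notin> J} u \<partial>lborel)
      + (\<integral>\<^sup>+y. (\<integral>\<^sup>+u. ennreal (g u) * indicator {u \<in> ?S. ?Q u = y} u \<partial>lborel) \<partial>count_space J)
      = (\<integral>\<^sup>+u. ennreal (g u) * indicator ?S u \<partial>lborel)"
    by (rule nn_integral_split_countable_values[OF _ _ _ J, symmetric]) auto
  finally show ?thesis .
qed

section \<open>Dependence coefficient\<close>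

text \<open>The norm \<open>A\<^sub>q\<close> of a Bernoulli variable of mean \<open>r\<close>.\<close>

definition bernoulli_norm :: "real \<Rightarrow> real \<Rightarrow> real" where
  "bernoulli_norm q r = (r * (1 - r) powr q + (1 - r) * r powr q) powr (1 / q)"

lemma bernoulli_norm_nonneg [simp]: "0 \<le> bernoulli_norm q r"
  by (simp add: bernoulli_norm_def)

lemma bernoulli_norm_pos: "0 < r \<Longrightarrow> r < 1 \<Longrightarrow> 0 < bernoulli_norm q r"
proof -
  assume "0 < r" "r < 1"
  then have "0 < r * (1 - r) powr q + (1 - r) * r powr q"
    by (intro add_pos_pos mult_pos_pos) auto
  then show ?thesis by (simp add: bernoulli_norm_def)
qed

lemma measurable_bernoulli_norm [measurable]: "bernoulli_norm q \<in> borel_measurable borel"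
  unfolding bernoulli_norm_def[abs_def] by measurable

text \<open>The limits \<open>r = 0\<close> and \<open>r = 1\<close> are included. There
  \<open>powr\<close> has base 0, where continuity comes from the positive exponent and from bases
  that stay non-negative.\<close>

lemma tendsto_bernoulli_norm:
  assumes "0 < q" "(f \<longlongrightarrow> r) F" "eventually (\<lambda>x. 0 \<le> f x \<and> f x \<le> 1) F"
  shows "((\<lambda>x. bernoulli_norm q (f x)) \<longlongrightarrow> bernoulli_norm q r) F"
  unfolding bernoulli_norm_def
proof (rule tendsto_powr')
  show "((\<lambda>x. f x * (1 - f x) powr q + (1 - f x) * f x powr q)
      \<longlongrightarrow> r * (1 - r) powr q + (1 - r) * r powr q) F"
  proof (intro tendsto_add tendsto_mult tendsto_diff tendsto_const assms(2) tendsto_powr')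
    show "1 - r \<noteq> 0 \<or> 0 < q \<and> (\<forall>\<^sub>F x in F. 0 \<le> 1 - f x)" "r \<noteq> 0 \<or> 0 < q \<and> (\<forall>\<^sub>F x in F. 0 \<le> f x)"
      using assms(1,3) by (auto elim: eventually_mono)
  qed
  show "r * (1 - r) powr q + (1 - r) * r powr q \<noteq> 0 \<or>
      0 < 1 / q \<and> (\<forall>\<^sub>F x in F. 0 \<le> f x * (1 - f x) powr q + (1 - f x) * f x powr q)"
    using assms(1,3) by (auto elim: eventually_mono)
qed simp

lemma tau_eq_indicator: "tau u t = indicator {u<..} t"
  by (simp add: tau_def indicator_def)

section \<open>Covariances with indicators of half-lines\<close>

context prob_space
begin

text \<open>Centring \<open>X\<close> is enough: the constant \<open>expectation T\<close> is
  integrated against a variable of mean zero.\<close>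

lemma covar_eq:
  assumes "integrable M X" "integrable M T" "integrable M (\<lambda>\<omega>. X \<omega> * T \<omega>)"
  shows "integrable M (\<lambda>\<omega>. (X \<omega> - expectation X) * T \<omega>)"
    and "covar M X T = expectation (\<lambda>\<omega>. (X \<omega> - expectation X) * T \<omega>)"
proof -
  show *: "integrable M (\<lambda>\<omega>. (X \<omega> - expectation X) * T \<omega>)"
    using assms by (simp add: left_diff_distrib)
  have "expectation (\<lambda>\<omega>. (X \<omega> - expectation X) * expectation T) = 0"
    using assms by (simp add: prob_space)
  then show "covar M X T = expectation (\<lambda>\<omega>. (X \<omega> - expectation X) * T \<omega>)"
    using * assms unfolding covar_def by (simp add: right_diff_distrib)
qed

lemma central_norm_tau:
  fixes Y :: "'a \<Rightarrow> real"
  assumes [measurable]: "Y \<in> borel_measurable M" and "0 < q"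
  shows "central_norm M q (\<lambda>\<omega>. tau y (Y \<omega>)) = bernoulli_norm q (measure (distr M borel Y) {y<..})"
proof -
  define r where "r = measure (distr M borel Y) {y<..}"
  have r01: "0 \<le> r" "r \<le> 1"
    by (simp_all add: r_def measure_distr)
  have int: "integrable M (\<lambda>\<omega>. tau y (Y \<omega>))"
    by (rule integrable_const_bound[of _ 1]) auto
  have Er: "expectation (\<lambda>\<omega>. tau y (Y \<omega>)) = r"
  proof -
    have "expectation (\<lambda>\<omega>. tau y (Y \<omega>)) = integral\<^sup>L (distr M borel Y) (indicator {y<..})"
      by (subst integral_distr) (auto simp: tau_eq_indicator)
    then show ?thesis by (simp add: r_def)
  qed
  \<comment> \<open>As \<open>tau\<close> takes only the values 0 and 1, any function of it is
    affine in it.\<close>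
  have "expectation (\<lambda>\<omega>. \<bar>tau y (Y \<omega>) - r\<bar> powr q)
      = expectation (\<lambda>\<omega>. (1 - r) powr q * tau y (Y \<omega>) + r powr q * (1 - tau y (Y \<omega>)))"
    using r01 by (intro Bochner_Integration.integral_cong) (auto simp: tau_def)
  also have "\<dots> = (1 - r) powr q * r + r powr q * (1 - r)"
    using int Er by (simp add: prob_space)
  finally show ?thesis
    by (simp add: central_norm_def Er bernoulli_norm_def r_def[symmetric] mult.commute)
qed

text \<open>The indicator is almost surely 0 or almost surely 1, and in the second case the mean of
  \<open>Z\<close> remains. This handles the half-lines that the supremum in the dependence
  coefficient leaves out.\<close>

lemma expectation_indicator_trivial:
  fixes Y Z :: "'a \<Rightarrow> real"
  assumes Z: "integrable M Z" "expectation Z = 0" and [measurable]: "Y \<in> borel_measurable M" "U \<in> sets borel"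
    and U: "measure (distr M borel Y) U = 0 \<or> measure (distr M borel Y) U = 1"
  shows "expectation (\<lambda>\<omega>. Z \<omega> * indicator U (Y \<omega>)) = 0"
proof -
  have [measurable]: "Z \<in> borel_measurable M" using Z by simp
  have P: "measure (distr M borel Y) U = prob {\<omega> \<in> space M. Y \<omega> \<in> U}"
    by (simp add: measure_distr vimage_def Int_def conj_commute)
  show ?thesis
    using U unfolding P
  proof
    assume "prob {\<omega> \<in> space M. Y \<omega> \<in> U} = 0"
    then have "AE \<omega> in M. Y \<omega> \<notin> U"
      by (subst (asm) prob_Collect_eq_0) auto
    then have "AE \<omega> in M. Z \<omega> * indicator U (Y \<omega>) = 0"
      by eventually_elim simp
    then show ?thesis by (rule integral_eq_zero_AE)
  next
    assume "prob {\<omega> \<in> space M. Y \<omega> \<in> U} = 1"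
    then have "AE \<omega> in M. Y \<omega> \<in> U"
      by (subst (asm) prob_Collect_eq_1) auto
    then have "AE \<omega> in M. Z \<omega> * indicator U (Y \<omega>) = Z \<omega>"
      by eventually_elim simp
    then have "expectation (\<lambda>\<omega>. Z \<omega> * indicator U (Y \<omega>)) = expectation Z"
      by (intro integral_cong_AE) measurable
    then show ?thesis using Z by simp
  qed
qed

text \<open>The indicators of \<open>{z<..}\<close> converge to that of \<open>{y..}\<close> as
  \<open>z\<close> increases to \<open>y\<close>, and both sides of the bound follow by dominated
  convergence.\<close>

lemma atLeast_bound_if_greaterThan_bound:
  fixes Y Z :: "'a \<Rightarrow> real"
  assumes Z: "integrable M Z" "expectation Z = 0" and [measurable]: "Y \<in> borel_measurable M"
    and q: "0 < q"
    and bound: "\<And>y. ennreal \<bar>expectation (\<lambda>\<omega>. Z \<omega> * indicator {y<..} (Y \<omega>))\<bar>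
        \<le> K * ennreal (bernoulli_norm q (measure (distr M borel Y) {y<..}))"
  shows "ennreal \<bar>expectation (\<lambda>\<omega>. Z \<omega> * indicator {y..} (Y \<omega>))\<bar>
        \<le> K * ennreal (bernoulli_norm q (measure (distr M borel Y) {y..}))"
proof -
  interpret D: prob_space "distr M borel Y" by (rule prob_space_distr) simp
  have [measurable]: "Z \<in> borel_measurable M" using Z by simp
  let ?r = "measure (distr M borel Y) {y..}"
  \<comment> \<open>Probabilities 0 and 1 come first: there the right side is 0 even for
    \<open>K = \<top>\<close>, so the left side must vanish by itself. Otherwise an infinite
    \<open>K\<close> makes the right side infinite, and a finite \<open>K\<close> lets the limit
    pass through the product.\<close>
  show ?thesis
  proof (cases "?r = 0 \<or> ?r = 1")
    case True
    then show ?thesis using expectation_indicator_trivial[OF Z, of Y "{y..}"] by simp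
  next
    case False
    then have "0 < ?r" "?r < 1"
      using D.prob_le_1[of "{y..}"] by (auto simp: less_le)
    then have pos: "0 < bernoulli_norm q ?r" by (rule bernoulli_norm_pos)
    show ?thesis
    proof (cases "K = \<top>")
      case True
      then show ?thesis using pos by (simp add: ennreal_top_mult)
    next
      case False
      define z where "z n = y - 1 / Suc n" for n
      have z_less: "z n < y" for n by (simp add: z_def)
      have z_lim: "z \<longlonglongrightarrow> y"
        unfolding z_def using tendsto_diff[OF tendsto_const[of y] LIMSEQ_inverse_real_of_nat]
        by (simp add: inverse_eq_divide)
      have ind: "(\<lambda>n. indicator {z n<..} t :: real) \<longlonglongrightarrow> indicator {y..} t" for t
      proof (cases "y \<le> t")
        case True
        then show ?thesis using less_le_trans[OF z_less] by simp
      next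
        case False
        then have "\<forall>\<^sub>F n in sequentially. t < z n"
          using z_lim by (intro order_tendstoD) auto
        then have "\<forall>\<^sub>F n in sequentially. indicator {z n<..} t = (indicator {y..} t :: real)"
          by eventually_elim (use False in auto)
        then show ?thesis by (rule tendsto_eventually)
      qed
      have lim1: "(\<lambda>n. expectation (\<lambda>\<omega>. Z \<omega> * indicator {z n<..} (Y \<omega>)))
          \<longlonglongrightarrow> expectation (\<lambda>\<omega>. Z \<omega> * indicator {y..} (Y \<omega>))"
      proof (rule integral_dominated_convergence)
        show "integrable M (\<lambda>\<omega>. \<bar>Z \<omega>\<bar>)" using Z by simp
        show "AE \<omega> in M. (\<lambda>n. Z \<omega> * indicator {z n<..} (Y \<omega>)) \<longlonglongrightarrow> Z \<omega> * indicator {y..} (Y \<omega>)"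
          by (intro AE_I2 tendsto_mult tendsto_const ind)
        show "AE \<omega> in M. norm (Z \<omega> * indicator {z n<..} (Y \<omega>)) \<le> \<bar>Z \<omega>\<bar>" for n
          by (auto split: split_indicator)
      qed measurable
      have "(\<lambda>n. D.expectation (indicator {z n<..})) \<longlonglongrightarrow> (D.expectation (indicator {y..}) :: real)"
      proof (rule integral_dominated_convergence)
        show "AE t in distr M borel Y. (\<lambda>n. indicator {z n<..} t :: real) \<longlonglongrightarrow> indicator {y..} t"
          by (simp add: ind)
        show "AE t in distr M borel Y. norm (indicator {z n<..} t :: real) \<le> 1" for n
          by (auto split: split_indicator)
      qed auto
      then have lim2: "(\<lambda>n. measure (distr M borel Y) {z n<..}) \<longlonglongrightarrow> ?r" by simp
      show ?thesis
      proof (rule LIMSEQ_le)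
        show "(\<lambda>n. ennreal \<bar>expectation (\<lambda>\<omega>. Z \<omega> * indicator {z n<..} (Y \<omega>))\<bar>)
            \<longlonglongrightarrow> ennreal \<bar>expectation (\<lambda>\<omega>. Z \<omega> * indicator {y..} (Y \<omega>))\<bar>"
          by (intro tendsto_ennrealI tendsto_rabs lim1)
        show "(\<lambda>n. K * ennreal (bernoulli_norm q (measure (distr M borel Y) {z n<..})))
            \<longlonglongrightarrow> K * ennreal (bernoulli_norm q ?r)"
          using False q
          by (intro ennreal_tendsto_cmult tendsto_ennrealI tendsto_bernoulli_norm lim2)
             (auto simp: top.not_eq_extremum)
      qed (use bound in auto)
    qed
  qed
qed

text \<open>In the proper case this clears the denominator of the quotient under the supremum. When
  the half-line is trivial or \<open>X\<close> is almost surely constant, the left side is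
  0.\<close>

lemma dependence_coeff_bound:
  fixes Y :: "'a \<Rightarrow> real"
  assumes X: "integrable M X" and [measurable]: "Y \<in> borel_measurable M" and pq: "0 < p" "0 < q"
    and Xp: "integrable M (\<lambda>\<omega>. \<bar>X \<omega> - expectation X\<bar> powr p)"
  shows "ennreal \<bar>expectation (\<lambda>\<omega>. (X \<omega> - expectation X) * indicator {y<..} (Y \<omega>))\<bar>
      \<le> dependence_coeff M p q X Y * ennreal (central_norm M p X)
        * ennreal (bernoulli_norm q (measure (distr M borel Y) {y<..}))"
    (is "ennreal \<bar>?h\<bar> \<le> ?D * ennreal ?A * ennreal ?a")
proof -
  interpret D: real_distribution "distr M borel Y" by (rule real_distribution_distr) simp
  define Z where "Z \<omega> = X \<omega> - expectation X" for \<omega>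
  have Z: "integrable M Z" "expectation Z = 0"
    using X by (simp_all add: Z_def[abs_def] prob_space)
  have [measurable]: "Z \<in> borel_measurable M" using Z by simp
  have cdf: "measure (distr M borel Y) {y<..} = 1 - cdf (distr M borel Y) y"
    using D.prob_compl[of "{..y}"] by (simp add: cdf_def Compl_eq_Diff_UNIV[symmetric])
  consider (trivial) "measure (distr M borel Y) {y<..} = 0 \<or> measure (distr M borel Y) {y<..} = 1"
    | (degenerate) "?A = 0"
    | (proper) "0 < cdf (distr M borel Y) y" "cdf (distr M borel Y) y < 1" "0 < ?A"
    using D.cdf_bounded_prob[of y] D.cdf_nonneg[of y] unfolding cdf
    by (cases "?A = 0") (auto simp: central_norm_def less_le)
  then show ?thesis
  proof cases
    case trivial
    then have "?h = 0"
      using expectation_indicator_trivial[OF Z, of Y "{y<..}"] by (simp add: Z_def)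
    then show ?thesis by simp
  next
    case degenerate
    then have "expectation (\<lambda>\<omega>. \<bar>Z \<omega>\<bar> powr p) = 0"
      by (simp add: central_norm_def Z_def)
    \<comment> \<open>Integrability matters here: a non-integrable power would also have Bochner
      integral 0.\<close>
    then have "AE \<omega> in M. \<bar>Z \<omega>\<bar> powr p = 0"
      using Xp by (subst (asm) integral_nonneg_eq_0_iff_AE) (auto simp: Z_def)
    then have "AE \<omega> in M. (X \<omega> - expectation X) * indicator {y<..} (Y \<omega>) = 0"
      by eventually_elim (simp add: Z_def)
    then have "?h = 0" by (rule integral_eq_zero_AE)
    then show ?thesis by simp
  next
    case proper
    have tau: "integrable M (\<lambda>\<omega>. tau y (Y \<omega>))"
      by (rule integrable_const_bound[of _ 1]) auto
    have cov: "covar M X (\<lambda>\<omega>. tau y (Y \<omega>)) = ?h"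
      using covar_eq(2)[OF X tau integrable_mult_tau[OF X]] by (simp add: tau_eq_indicator)
    have a: "0 < ?a" "central_norm M q (\<lambda>\<omega>. tau y (Y \<omega>)) = ?a"
      using proper pq central_norm_tau[of Y q y] by (auto simp: cdf intro!: bernoulli_norm_pos)
    have "ennreal \<bar>?h\<bar> = ennreal (\<bar>?h\<bar> / (?A * ?a)) * ennreal ?A * ennreal ?a"
      using proper a by (simp flip: ennreal_mult)
    also have "ennreal (\<bar>?h\<bar> / (?A * ?a)) \<le> ?D"
      unfolding dependence_coeff_def using proper
      by (intro SUP_upper2[of y]) (auto simp: cov a)
    finally show ?thesis by (simp add: mult_right_mono)
  qed
qed

text \<open>The measure of the superlevel set decreases in \<open>u\<close>; the double negation
  presents it through a non-decreasing function.\<close>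

lemma measurable_bernoulli_norm_superlevel:
  fixes Y :: "'a \<Rightarrow> real" and v :: "real \<Rightarrow> real"
  assumes "Y \<in> borel_measurable M" "v \<in> borel_measurable borel"
  shows "(\<lambda>u. bernoulli_norm q (measure (distr M borel Y) {t. u < v t})) \<in> borel_measurable borel"
proof -
  interpret D: prob_space "distr M borel Y" using assms(1) by (rule prob_space_distr)
  have "mono (\<lambda>u. - measure (distr M borel Y) {t. u < v t})"
    using assms(2) by (intro monoI le_imp_neg_le D.finite_measure_mono) auto
  then have [measurable]: "(\<lambda>u. - (- measure (distr M borel Y) {t. u < v t})) \<in> borel_measurable borel"
    by (intro borel_measurable_uminus borel_measurable_mono)
  have "(\<lambda>u. bernoulli_norm q (- (- measure (distr M borel Y) {t. u < v t}))) \<in> borel_measurable borel"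
    by measurable
  then show ?thesis by simp
qed

text \<open>The left and right limits of the norm at \<open>y\<close> belong to the half-lines
  \<open>{y..}\<close> and \<open>{y<..}\<close>. Within a jump at \<open>y\<close> these are the
  superlevel sets of \<open>v\<close> for levels below and above \<open>v y\<close>, as the change
  of variables requires.\<close>

lemma stieltjes_nn_integral_central_norm_tau:
  fixes Y :: "'a \<Rightarrow> real"
  assumes [measurable]: "Y \<in> borel_measurable M" and q: "0 < q" and v: "mono v"
  shows "stieltjes_nn_integral (\<lambda>y. central_norm M q (\<lambda>\<omega>. tau y (Y \<omega>))) v =
    (\<integral>\<^sup>+u. ennreal (bernoulli_norm q (measure (distr M borel Y) {t. u < v t})) * indicator (levels v) u \<partial>lborel)"
proof -
  interpret D: real_distribution "distr M borel Y" by (rule real_distribution_distr) simp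
  let ?m = "measure (distr M borel Y)"
  have [measurable]: "v \<in> borel_measurable borel" using v by (rule borel_measurable_mono)
  have f: "(\<lambda>y. central_norm M q (\<lambda>\<omega>. tau y (Y \<omega>))) = (\<lambda>y. bernoulli_norm q (?m {y<..}))"
    using central_norm_tau[OF assms(1) q] by simp
  have cdf: "?m {y<..} = 1 - cdf (distr M borel Y) y" for y
    using D.prob_compl[of "{..y}"] by (simp add: cdf_def Compl_eq_Diff_UNIV[symmetric])
  have left_cdf: "?m {y..} = 1 - ?m {..<y}" for y
    using D.prob_compl[of "{..<y}"] by (simp add: Compl_eq_Diff_UNIV[symmetric])
  have right: "Lim (at_right y) (\<lambda>y. bernoulli_norm q (?m {y<..})) = bernoulli_norm q (?m {y<..})" for y
    using D.cdf_is_right_cont[of y] q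
    by (intro tendsto_Lim tendsto_bernoulli_norm) (auto simp: cdf continuous_within D.cdf_nonneg D.cdf_bounded_prob intro!: tendsto_diff)
  have left: "Lim (at_left y) (\<lambda>y. bernoulli_norm q (?m {y<..})) = bernoulli_norm q (?m {y..})" for y
    using D.cdf_at_left[of y] q
    by (intro tendsto_Lim tendsto_bernoulli_norm) (auto simp: cdf left_cdf D.cdf_nonneg D.cdf_bounded_prob intro!: tendsto_diff)
  show ?thesis
    unfolding f
  proof (rule stieltjes_nn_integral_eq_quantile[OF v])
    \<comment> \<open>The half-line \<open>{y<..}\<close> is the superlevel set at level
      \<open>y\<close> of the identity.\<close>
    show "(\<lambda>y. bernoulli_norm q (?m {y<..})) \<in> borel_measurable borel"
      using measurable_bernoulli_norm_superlevel[OF assms(1), of "\<lambda>t. t" q]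
      by (simp add: greaterThan_def)
    show "(\<lambda>u. bernoulli_norm q (?m {t. u < v t})) \<in> borel_measurable borel"
      by (rule measurable_bernoulli_norm_superlevel) measurable
  next
    fix u assume u: "u \<in> levels v" "Lim (at_left (quantile v u)) v = Lim (at_right (quantile v u)) v"
    let ?y = "quantile v u"
    \<comment> \<open>With no jump at the quantile, the one-sided limits squeeze \<open>u\<close>
      onto \<open>v ?y\<close>, so the endpoint is not in the superlevel set.\<close>
    have "u = v ?y"
      using u(2) quantile_bounds[OF v u(1)] Lim_at_left_le_self[OF v, of ?y] le_Lim_at_right_self[OF v, of ?y]
      by simp
    then have "{t. u < v t} = {?y<..}"
      using quantile_lessD[OF v u(1)] monoD[OF v, of _ ?y] by (force simp: not_less[symmetric])
    then show "bernoulli_norm q (?m {t. u < v t}) = bernoulli_norm q (?m {?y<..})" by simp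
  next
    fix y u assume u: "Lim (at_left y) v < u" "u < v y"
    have "{t. u < v t} = {y..}"
    proof (intro equalityI subsetI)
      fix t assume "t \<in> {t. u < v t}" then show "t \<in> {y..}"
        using u le_Lim_at_left[OF v, of t y] by (cases "t < y") auto
    next
      fix t assume "t \<in> {y..}" then show "t \<in> {t. u < v t}"
        using u monoD[OF v, of y t] by simp
    qed
    then show "bernoulli_norm q (?m {t. u < v t}) = Lim (at_left y) (\<lambda>y. bernoulli_norm q (?m {y<..}))"
      by (simp add: left)
  next
    fix y u assume u: "v y < u" "u < Lim (at_right y) v"
    have "{t. u < v t} = {y<..}"
    proof (intro equalityI subsetI)
      fix t assume "t \<in> {t. u < v t}" then show "t \<in> {y<..}"
        using u monoD[OF v, of t y] by (cases "t \<le> y") auto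
    next
      fix t assume "t \<in> {y<..}" then show "t \<in> {t. u < v t}"
        using u Lim_at_right_le[OF v, of y t] by simp
    qed
    then show "bernoulli_norm q (?m {t. u < v t}) = Lim (at_right y) (\<lambda>y. bernoulli_norm q (?m {y<..}))"
      by (simp add: right)
  qed (simp_all add: left right)
qed

end

section \<open>From the integral over levels to the product of the two factors\<close>

theorem theorem5p1:
  fixes M :: "'a measure" and X Y :: "'a \<Rightarrow> real"
    and \<beta> \<beta>\<^sub>1 \<beta>\<^sub>2 :: "real \<Rightarrow> real" and p q :: real
  assumes "prob_space M"
    and "X \<in> borel_measurable M" and "Y \<in> borel_measurable M"
    and "mono \<beta>\<^sub>1" and "mono \<beta>\<^sub>2" and "\<And>y. \<beta> y = \<beta>\<^sub>1 y - \<beta>\<^sub>2 y"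
    and "integrable M X"
    and "integrable M (\<lambda>\<omega>. \<beta> (Y \<omega>))"
    and "integrable M (\<lambda>\<omega>. X \<omega> * \<beta> (Y \<omega>))"
    and "1 < p" and "1 < q" and "1 / p + 1 / q = 1"
    and "integrable M (\<lambda>\<omega>. \<bar>X \<omega> - (\<integral>\<omega>'. X \<omega>' \<partial>M)\<bar> powr p)"
  shows "ennreal \<bar>covar M X (\<lambda>\<omega>. \<beta> (Y \<omega>))\<bar>
           \<le> dependence_coeff M p q X Y * gruess_factor M p q X Y (\<lambda>y. \<beta>\<^sub>1 y + \<beta>\<^sub>2 y)"
proof -
  interpret prob_space M by fact
  note [measurable] = assms(2,3)
  let ?v = "\<lambda>y. \<beta>\<^sub>1 y + \<beta>\<^sub>2 y"
  define Z where "Z \<omega> = X \<omega> - expectation X" for \<omega>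
  let ?b = "\<lambda>U. bernoulli_norm q (measure (distr M borel Y) U)"
  let ?K = "dependence_coeff M p q X Y * ennreal (central_norm M p X)"
  have Z: "integrable M Z" "expectation Z = 0"
    using \<open>integrable M X\<close> by (simp_all add: Z_def[abs_def] prob_space)
  have v: "mono ?v"
    using monoD[OF assms(4)] monoD[OF assms(5)] by (intro monoI add_mono)
  then have v_meas [measurable]: "?v \<in> borel_measurable borel" by (rule borel_measurable_mono)
  \<comment> \<open>The increments of \<open>\<beta>\<^sub>1\<close> and
    \<open>\<beta>\<^sub>2\<close> have the same sign, so their difference is at most their sum in
    absolute value.\<close>
  have "\<bar>\<beta> s - \<beta> t\<bar> \<le> \<bar>?v s - ?v t\<bar>" for s t
    using monoD[OF assms(4), of s t] monoD[OF assms(4), of t s]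
      monoD[OF assms(5), of s t] monoD[OF assms(5), of t s] assms(6)[of s] assms(6)[of t]
    by (cases "s \<le> t") auto
  then obtain B where B: "1-lipschitz_on UNIV B" "\<And>t. \<beta> t = B (?v t)"
    using lipschitz_factorization[of \<beta> ?v] by blast
  have bound: "ennreal \<bar>expectation (\<lambda>\<omega>. Z \<omega> * indicator {y<..} (Y \<omega>))\<bar> \<le> ?K * ennreal (?b {y<..})" for y
    unfolding Z_def using assms by (intro dependence_coeff_bound) auto
  have "ennreal \<bar>covar M X (\<lambda>\<omega>. \<beta> (Y \<omega>))\<bar> = ennreal \<bar>expectation (\<lambda>\<omega>. Z \<omega> * B (?v (Y \<omega>)))\<bar>"
    using covar_eq(2)[OF assms(7-9)] by (simp add: Z_def B)
  also have "\<dots> \<le> (\<integral>\<^sup>+u. ennreal \<bar>expectation (\<lambda>\<omega>. Z \<omega> * tau u (?v (Y \<omega>)))\<bar> \<partial>lborel)"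
    using covar_eq(1)[OF assms(7-9)]
    by (intro lipschitz_integral_bound[OF assms(1) Z _ B(1)]) (simp_all add: Z_def B)
  also have "\<dots> \<le> (\<integral>\<^sup>+u. ?K * (ennreal (?b {t. u < ?v t}) * indicator (levels ?v) u) \<partial>lborel)"
  proof (rule nn_integral_mono)
    fix u
    have eq: "tau u (?v t) = indicator {t. u < ?v t} t" for t
      by (simp add: tau_def)
    show "ennreal \<bar>expectation (\<lambda>\<omega>. Z \<omega> * tau u (?v (Y \<omega>)))\<bar>
        \<le> ?K * (ennreal (?b {t. u < ?v t}) * indicator (levels ?v) u)"
    proof (cases "u \<in> levels ?v")
      case True
      have "ennreal \<bar>expectation (\<lambda>\<omega>. Z \<omega> * indicator {t. u < ?v t} (Y \<omega>))\<bar> \<le> ?K * ennreal (?b {t. u < ?v t})"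
        using levels_half_line[OF v True]
      proof
        assume "{t. u < ?v t} = {quantile ?v u<..}"
        then show ?thesis using bound by simp
      next
        assume *: "{t. u < ?v t} = {quantile ?v u..}"
        show ?thesis unfolding *
          by (rule atLeast_bound_if_greaterThan_bound[OF Z]) (use \<open>1 < q\<close> bound in auto)
      qed
      then show ?thesis unfolding eq using True by simp
    next
      case False
      \<comment> \<open>At such levels the integrand is 0 because \<open>Z\<close> has mean zero, so
        the restriction to \<open>levels\<close> loses nothing.\<close>
      then have "{t. u < ?v t} = {} \<or> {t. u < ?v t} = UNIV"
        by (auto simp: levels_def not_le)
      then have "expectation (\<lambda>\<omega>. Z \<omega> * indicator {t. u < ?v t} (Y \<omega>)) = 0"
        using Z by (elim disjE) simp_all
      then show ?thesis unfolding eq by simp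
    qed
  qed
  also have "\<dots> = ?K * stieltjes_nn_integral (\<lambda>y. central_norm M q (\<lambda>\<omega>. tau y (Y \<omega>))) ?v"
    unfolding stieltjes_nn_integral_central_norm_tau[OF assms(3) less_trans[OF zero_less_one \<open>1 < q\<close>] v]
    using levels_borel[OF v] measurable_bernoulli_norm_superlevel[OF assms(3) v_meas, of q]
    by (intro nn_integral_cmult) simp
  finally show ?thesis
    by (simp add: gruess_factor_def mult.assoc)
qed

end
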